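(* Let $p>1$ and $x\in C([0,1];\mathbb R)$, with affine increment $a=x(1)-x(0)$ and dyadic Faber–Schauder coefficients $\theta=(\theta_{m,k})$. Let $Z_{m,j}=Z_{m,j}(a,\theta)$ and $P^{b,r}_{m,j}=P^{b,r}_{m,j}(a,\theta)$ be the coefficient fields defined in the context. For $m\ge1$, define $A_m$ at dyadic points by $$A_m(k2^{-m}):=2^{-m}\sum_{j=0}^{k-1}|Z_{m,j}(a,\theta)|^p,\qquad 0\le k\le2^m,$$ and extend $A_m$ linearly on each dyadic cell. Then $x$ is $p$-rough if and only if the following three conditions hold: (i) $\displaystyle \lim_{M\to\infty}\sup_{m,n\ge M}\max_{s\in\mathbb T_{\max(m,n)}}|A_m(s)-A_n(s)|=0$; (ii) $\displaystyle \liminf_{m\to\infty}2^{-m}\sum_{j=0}^{2^m-1}|Z_{m,j}(a,\theta)|^p>0$; (iii) $\displaystyle \lim_{L\to\infty}\limsup_{m\to\infty}\sup_{L\le b\le\lfloor2^m/L\rfloor,\ 0\le r<b}\ \sup_{s\in\mathbb T_m}\left|2^{-m}\sum_{j\ge0:\,j2^{-m}<s}\mathfrak d_p\bigl(P^{b,r}_{m,j}(a,\theta),Z_{m,j}(a,\theta)\bigr)\right|=0.$ When these conditions hold, $[x]^p(t)=\lim_{m\to\infty}A_m(t)$ uniformly for $t\in[0,1]$.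
   Context: $p$-roughness on $[0,1]$: for a finite partition $\lambda=\{0=u_0<\dots<u_N=1\}$ put $\mathsf V^p_\lambda(x;t):=\sum_i|x(u_{i+1}\wedge t)-x(u_i\wedge t)|^p$; for $0<\ell\le1$, $0\le c<\ell$ put $\Pi(\ell,c):=\{0,1\}\cup\{c+k\ell:k\in\mathbb Z,\ 0<c+k\ell<1\}$. $x$ is $p$-rough if there is a continuous nondecreasing $A:[0,1]\to[0,\infty)$ with $A(1)>A(0)=0$ such that $\sup_{0<\ell\le\delta}\sup_{0\le c<\ell}\sup_{t\in[0,1]}|\mathsf V^p_{\Pi(\ell,c)}(x;t)-A(t)|\to0$ as $\delta\downarrow0$; $A$ is then unique and denoted $[x]^p$. $\mathbb T_m:=\{j2^{-m}:0\le j\le2^m\}$. $\mathfrak d_p(u,v):=|u+v|^p-|u|^p-|v|^p$. Dyadic Faber–Schauder coefficients: for $m\ge0$, $0\le k<2^m$, $$\theta_{m,k}=2^{m/2}\left(2x\bigl(\tfrac{2k+1}{2^{m+1}}\bigr)-x\bigl(\tfrac{k}{2^m}\bigr)-x\bigl(\tfrac{k+1}{2^m}\bigr)\right),$$ which are the coefficients in $x(t)=x(0)+at+\sum_{m\ge0}\sum_{k}\theta_{m,k}e_{m,k}(t)$ with $e_{m,k}(t)=2^{-m/2}\varphi(2^mt-k)$, $\varphi(u)=\max\{0,\min\{u,1-u\}\}$. For $0\le\ell<m$, $0\le j<2^m$: $\kappa(\ell;m,j):=\lfloor j/2^{m-\ell}\rfloor$, and $\varepsilon_\ell(m,j)\in\{-1,1\}$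 is $+1$ if the interval $(j2^{-m},(j+1)2^{-m})$ lies in the left half of $[\kappa2^{-\ell},(\kappa+1)2^{-\ell}]$ with $\kappa=\kappa(\ell;m,j)$, and $-1$ if it lies in the right half. Define, for $m\ge1$ and $0\le j<2^m$, $$Z_{m,j}(a,\theta):=2^{-m(1-1/p)}\left[a+\sum_{\ell=0}^{m-1}2^{\ell/2}\theta_{\ell,\kappa(\ell;m,j)}\,\varepsilon_\ell(m,j)\right].$$ For integers $1\le b\le2^m$, $0\le r<b$: $\beta_{b,r}(j):=\max\{0,\ r+b\lfloor (j-r)/b\rfloor\}$ and $P^{b,r}_{m,j}(a,\theta):=\sum_{i=\beta_{b,r}(j)}^{j-1}Z_{m,i}(a,\theta)$ (empty sum $=0$). $L$ ranges over integers $\ge2$. *)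

theory Defs
  imports "HOL-Analysis.Analysis"
begin

text \<open>Suprema of nonnegative quantities are taken in \<^typ>\<open>ennreal\<close>: they may be infinite, and on
  type \<^typ>\<open>real\<close> the supremum of an unbounded set is an unspecified number.\<close>

text \<open>A finite partition is represented by its set of points.\<close>

definition p_sum :: "real \<Rightarrow> real set \<Rightarrow> (real \<Rightarrow> real) \<Rightarrow> real \<Rightarrow> real" where
  "p_sum p S x t =
     (let u = sorted_list_of_set S
      in \<Sum>i<card S - 1. \<bar>x (min (u ! Suc i) t) - x (min (u ! i) t)\<bar> powr p)"

definition shifted_grid :: "real \<Rightarrow> real \<Rightarrow> real set" where
  "shifted_grid l c =
     {0, 1} \<union> {c + real_of_int k * l | k :: int. 0 < c + real_of_int k * l \<and> c + real_of_int k * l < 1}"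

definition is_rough_variation :: "real \<Rightarrow> (real \<Rightarrow> real) \<Rightarrow> (real \<Rightarrow> real) \<Rightarrow> bool" where
  "is_rough_variation p x A \<longleftrightarrow>
     continuous_on {0..1} A \<and> mono_on {0..1} A \<and> (\<forall>t\<in>{0..1}. 0 \<le> A t) \<and> A 0 = 0 \<and> A 1 > A 0 \<and>
     ((\<lambda>\<delta>. SUP l\<in>{0<..\<delta>}. SUP c\<in>{0..<l}. SUP t\<in>{0..1}.
         ennreal \<bar>p_sum p (shifted_grid l c) x t - A t\<bar>) \<longlongrightarrow> 0) (at_right 0)"

definition p_rough :: "real \<Rightarrow> (real \<Rightarrow> real) \<Rightarrow> bool" where
  "p_rough p x \<longleftrightarrow> (\<exists>A. is_rough_variation p x A)"

text \<open>The function \<open>[x]\<^sup>p\<close>. It is unique only on the unit interval, so it is pinned down outside by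
  extensionality; see \<open>rough_variation_eq\<close> below.\<close>

definition rough_variation :: "real \<Rightarrow> (real \<Rightarrow> real) \<Rightarrow> real \<Rightarrow> real" where
  "rough_variation p x = (THE A. is_rough_variation p x A \<and> A \<in> extensional {0..1})"

lemma is_rough_variation_unique:
  assumes A: "is_rough_variation p x A" and B: "is_rough_variation p x B" and t: "t \<in> {0..1}"
  shows "A t = B t"
proof -
  define F where "F C \<delta> = (SUP l\<in>{0<..\<delta>}. SUP c\<in>{0..<l}. SUP t\<in>{0..1}.
         ennreal \<bar>p_sum p (shifted_grid l c) x t - C t\<bar>)" for C :: "real \<Rightarrow> real" and \<delta> :: real
  have le: "ennreal \<bar>p_sum p (shifted_grid \<delta> 0) x t - C t\<bar> \<le> F C \<delta>" if "\<delta> > 0" for C \<delta>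
    unfolding F_def using that t
    by (intro SUP_upper2[of \<delta>] SUP_upper2[of 0] SUP_upper2[of t]) auto
  have "ennreal \<bar>A t - B t\<bar> \<le> F A \<delta> + F B \<delta>" if "\<delta> > 0" for \<delta>
  proof -
    have "ennreal \<bar>A t - B t\<bar> \<le> ennreal (\<bar>p_sum p (shifted_grid \<delta> 0) x t - A t\<bar>
        + \<bar>p_sum p (shifted_grid \<delta> 0) x t - B t\<bar>)"
      by (intro ennreal_leI) linarith
    also have "\<dots> = ennreal \<bar>p_sum p (shifted_grid \<delta> 0) x t - A t\<bar>
        + ennreal \<bar>p_sum p (shifted_grid \<delta> 0) x t - B t\<bar>"
      by (intro ennreal_plus) auto
    also have "\<dots> \<le> F A \<delta> + F B \<delta>"
      using le[OF that, of A] le[OF that, of B] by (intro add_mono)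
    finally show ?thesis .
  qed
  then have "\<forall>\<^sub>F \<delta> in at_right 0. ennreal \<bar>A t - B t\<bar> \<le> F A \<delta> + F B \<delta>"
    by (auto simp: eventually_at_right_field intro: exI[of _ 1])
  moreover have "((\<lambda>\<delta>. F A \<delta> + F B \<delta>) \<longlongrightarrow> 0 + 0) (at_right 0)"
    using A B unfolding is_rough_variation_def F_def by (intro tendsto_add) auto
  ultimately have "ennreal \<bar>A t - B t\<bar> \<le> 0 + 0"
    by (intro tendsto_lowerbound) auto
  then show ?thesis by (simp add: ennreal_eq_0_iff)
qed

lemma is_rough_variation_cong:
  assumes "\<And>t. t \<in> {0..1} \<Longrightarrow> A t = B t"
  shows "is_rough_variation p x A \<longleftrightarrow> is_rough_variation p x B"
proof -
  have "continuous_on {0..1} A \<longleftrightarrow> continuous_on {0..1} B"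
    using assms by (intro continuous_on_cong) auto
  moreover have "mono_on {0..1} A \<longleftrightarrow> mono_on {0..1} B"
    using assms by (auto simp: mono_on_def)
  ultimately show ?thesis
    using assms by (simp add: is_rough_variation_def cong: SUP_cong_simp)
qed

lemma rough_variation_eq:
  assumes "is_rough_variation p x A" and "t \<in> {0..1}"
  shows "rough_variation p x t = A t"
proof -
  have "is_rough_variation p x (restrict A {0..1})"
    using assms(1) by (subst is_rough_variation_cong[of _ A]) auto
  then have "rough_variation p x = restrict A {0..1}"
    unfolding rough_variation_def
    by (intro the_equality conjI restrict_extensional extensionalityI[of _ "{0..1}"])
       (auto dest: is_rough_variation_unique)
  with assms(2) show ?thesis by simp
qed

definition dyadics :: "nat \<Rightarrow> real set" where
  "dyadics m = {real j / 2 ^ m | j :: nat. j \<le> 2 ^ m}"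

definition cross_term :: "real \<Rightarrow> real \<Rightarrow> real \<Rightarrow> real" where
  "cross_term p u v = \<bar>u + v\<bar> powr p - \<bar>u\<bar> powr p - \<bar>v\<bar> powr p"

definition fs_coeff :: "(real \<Rightarrow> real) \<Rightarrow> nat \<Rightarrow> nat \<Rightarrow> real" where
  "fs_coeff x m k = 2 powr (real m / 2) *
     (2 * x ((2 * real k + 1) / 2 ^ (m + 1)) - x (real k / 2 ^ m) - x ((real k + 1) / 2 ^ m))"

definition ancestor :: "nat \<Rightarrow> nat \<Rightarrow> nat \<Rightarrow> nat" where
  "ancestor l m j = j div 2 ^ (m - l)"

text \<open>For \<open>l < m\<close> a dyadic cell of level \<open>m\<close> that is not inside the left half of its ancestor
  cell of level \<open>l\<close> is inside the right half.\<close>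

definition half_sign :: "nat \<Rightarrow> nat \<Rightarrow> nat \<Rightarrow> real" where
  "half_sign l m j =
     (let k = real (ancestor l m j)
      in if {real j / 2 ^ m <..< (real j + 1) / 2 ^ m} \<subseteq> {k / 2 ^ l .. (k + 1 / 2) / 2 ^ l}
         then 1 else - 1)"

definition fs_Z :: "real \<Rightarrow> real \<Rightarrow> (nat \<Rightarrow> nat \<Rightarrow> real) \<Rightarrow> nat \<Rightarrow> nat \<Rightarrow> real" where
  "fs_Z p a \<theta> m j = 2 powr (- real m * (1 - 1 / p)) *
     (a + (\<Sum>l<m. 2 powr (real l / 2) * \<theta> l (ancestor l m j) * half_sign l m j))"

definition block_start :: "nat \<Rightarrow> nat \<Rightarrow> nat \<Rightarrow> nat" where
  "block_start b r j = nat (max 0 (int r + int b * ((int j - int r) div int b)))"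

definition fs_P :: "real \<Rightarrow> real \<Rightarrow> (nat \<Rightarrow> nat \<Rightarrow> real) \<Rightarrow> nat \<Rightarrow> nat \<Rightarrow> nat \<Rightarrow> nat \<Rightarrow> real" where
  "fs_P p a \<theta> b r m j = (\<Sum>i = block_start b r j..<j. fs_Z p a \<theta> m i)"

definition fs_A_dyadic :: "real \<Rightarrow> real \<Rightarrow> (nat \<Rightarrow> nat \<Rightarrow> real) \<Rightarrow> nat \<Rightarrow> nat \<Rightarrow> real" where
  "fs_A_dyadic p a \<theta> m k = (\<Sum>j<k. \<bar>fs_Z p a \<theta> m j\<bar> powr p) / 2 ^ m"

text \<open>Linear interpolation on the cells; at \<open>t = 1\<close> the weight \<open>w\<close> vanishes, so the value of
  \<^const>\<open>fs_A_dyadic\<close> beyond the grid plays no role for \<open>t\<close> in the unit interval.\<close>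

definition fs_A :: "real \<Rightarrow> real \<Rightarrow> (nat \<Rightarrow> nat \<Rightarrow> real) \<Rightarrow> nat \<Rightarrow> real \<Rightarrow> real" where
  "fs_A p a \<theta> m t =
     (let k = nat \<lfloor>2 ^ m * t\<rfloor>; w = 2 ^ m * t - real k
      in (1 - w) * fs_A_dyadic p a \<theta> m k + w * fs_A_dyadic p a \<theta> m (k + 1))"

definition dyadic_cauchy :: "real \<Rightarrow> real \<Rightarrow> (nat \<Rightarrow> nat \<Rightarrow> real) \<Rightarrow> bool" where
  "dyadic_cauchy p a \<theta> \<longleftrightarrow>
     (\<lambda>M. SUP m\<in>{M..}. SUP n\<in>{M..}.
        ennreal (MAX s\<in>dyadics (max m n). \<bar>fs_A p a \<theta> m s - fs_A p a \<theta> n s\<bar>)) \<longlonglongrightarrow> 0"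

definition dyadic_nondegenerate :: "real \<Rightarrow> real \<Rightarrow> (nat \<Rightarrow> nat \<Rightarrow> real) \<Rightarrow> bool" where
  "dyadic_nondegenerate p a \<theta> \<longleftrightarrow>
     liminf (\<lambda>m. ennreal ((\<Sum>j<2 ^ m. \<bar>fs_Z p a \<theta> m j\<bar> powr p) / 2 ^ m)) > 0"

definition block_cancellation :: "real \<Rightarrow> real \<Rightarrow> (nat \<Rightarrow> nat \<Rightarrow> real) \<Rightarrow> bool" where
  "block_cancellation p a \<theta> \<longleftrightarrow>
     (\<lambda>L. limsup (\<lambda>m. SUP b\<in>{L..2 ^ m div L}. SUP r\<in>{..<b}. SUP s\<in>dyadics m.
        ennreal \<bar>(\<Sum>j | real j / 2 ^ m < s.
          cross_term p (fs_P p a \<theta> b r m j) (fs_Z p a \<theta> m j)) / 2 ^ m\<bar>)) \<longlonglongrightarrow> 0"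

end

theory Submission
  imports Defs
begin

text \<open>The partial Faber--Schauder sums are the slopes of the dyadic interpolations of \<open>x\<close>, so
  \<open>Z\<^bsub>m,j\<^esub>\<close> is \<open>2\<^bsup>m/p\<^esup>\<close> times the increment of \<open>x\<close> over the \<open>j\<close>-th cell and \<open>A\<^sub>m\<close> is the
  stopped \<open>p\<close>-variation sum along the dyadic grid. The cross terms in (iii) telescope within each
  block, and their sum is the difference between the stopped variation sum along the grid of mesh
  \<open>b/2\<^bsup>m\<^esup>\<close> and shift \<open>r/2\<^bsup>m\<^esup>\<close> and \<open>A\<^sub>m\<close>. Roughness therefore gives the three conditions at once.
  Conversely, (i) provides a continuous limit of the \<open>A\<^sub>m\<close>, and an arbitrary grid with fixed mesh \<open>l\<close>
  and shift \<open>c\<close> is approximated by dyadic ones: once its points are clamped to \<open>[0,t]\<close>, the variation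
  sum is a fixed finite sum that is jointly continuous in \<open>(l,c,t)\<close>, so the bound of (iii) passes to
  the limit \<open>m \<rightarrow> \<infinity>\<close>.\<close>

subsection \<open>Faber--Schauder sums as increments\<close>

text \<open>A level-\<open>l\<close> cell consists of \<open>2 * q\<close> level-\<open>m\<close>
  cells, where \<open>q = 2 ^ (m - Suc l)\<close>, and its left half is the first \<open>q\<close>
  of them. The geometric sign is therefore a binary digit of \<open>j\<close>.\<close>

lemma half_sign_eq:
  assumes "l < m"
  shows "half_sign l m j = (if even (j div 2 ^ (m - Suc l)) then 1 else - 1)"
proof -
  define q :: nat where "q = 2 ^ (m - Suc l)"
  define k where "k = j div (2 * q)"
  have q: "q > 0" by (simp add: q_def)
  have pow: "2 ^ (m - l) = 2 * q"
    using assms by (simp add: q_def flip: power_Suc Suc_diff_Suc)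
  have "m = l + Suc (m - Suc l)"
    using assms by simp
  then have "(2::real) ^ m = 2 ^ (l + Suc (m - Suc l))" by (rule arg_cong)
  then have powm: "(2::real) ^ m = 2 ^ l * (2 * real q)"
    unfolding q_def power_add power_Suc of_nat_power by simp
  have split: "j = k * (2 * q) + j mod (2 * q)"
    by (simp only: k_def div_mult_mod_eq)
  have "half_sign l m j = 1 \<longleftrightarrow>
      {real j / 2 ^ m <..< (real j + 1) / 2 ^ m} \<subseteq> {real k / 2 ^ l .. (real k + 1 / 2) / 2 ^ l}"
    unfolding half_sign_def ancestor_def Let_def pow k_def by simp
  also have "\<dots> \<longleftrightarrow> real k / 2 ^ l \<le> real j / 2 ^ m \<and> (real j + 1) / 2 ^ m \<le> (real k + 1 / 2) / 2 ^ l"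
    by (subst greaterThanLessThan_subseteq_atLeastAtMost_iff) (auto simp: divide_strict_right_mono)
  also have "\<dots> \<longleftrightarrow> real k * (2 * real q) \<le> real j \<and> 1 + real j \<le> real k * (2 * real q) + real q"
  proof -
    have cancel: "v / (2 ^ l * (2 * real q)) = v / (2 * real q) / 2 ^ l" for v by simp
    show ?thesis
      unfolding powm cancel divide_le_cancel using q by (auto simp: field_simps)
  qed
  also have "\<dots> \<longleftrightarrow> k * (2 * q) \<le> j \<and> j + 1 \<le> k * (2 * q) + q"
    by (simp flip: of_nat_le_iff[where 'a = real])
  also have "\<dots> \<longleftrightarrow> j mod (2 * q) < q"
    using split by linarith
  also have "\<dots> \<longleftrightarrow> even (j div q)"
  proof -
    \<comment> \<open>Splits off the lowest binary digit of \<open>j div q\<close>; the remainder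
      modulo \<open>2 * q\<close> is below \<open>q\<close> exactly when this digit is 0.\<close>
    have "j mod (2 * q) = j mod q + q * (j div q mod 2)"
      by (metis mod_mult2_eq mult.commute add.commute)
    moreover have "j mod q < q" using q by simp
    ultimately show ?thesis
      by (cases "even (j div q)") (auto simp: odd_iff_mod_2_eq_one)
  qed
  finally have "half_sign l m j = 1 \<longleftrightarrow> even (j div q)" .
  moreover have "half_sign l m j = 1 \<or> half_sign l m j = - 1"
    by (simp add: half_sign_def Let_def)
  ultimately show ?thesis by (auto simp: q_def)
qed

text \<open>Passing from a cell \<open>i\<close> to its child \<open>j\<close> adds a single term.
  The coefficient at \<open>i\<close> is a scaled second difference at the midpoint, which is the
  change from the slope on the parent to the slope on its left half; on the right half the change
  has the opposite sign.\<close>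

lemma faber_schauder_slope:
  assumes "j < 2 ^ m"
  shows "x 1 - x 0 + (\<Sum>l<m. 2 powr (real l / 2) * fs_coeff x l (ancestor l m j) * half_sign l m j) =
    2 ^ m * (x (real (Suc j) / 2 ^ m) - x (real j / 2 ^ m))"
  using assms
proof (induction m arbitrary: j)
  case 0
  then show ?case by simp
next
  case (Suc m)
  define i where "i = j div 2"
  have anc: "ancestor l (Suc m) j = ancestor l m i" if "l \<le> m" for l
    using that by (simp add: ancestor_def i_def Suc_diff_le div_mult2_eq)
  have sgn: "half_sign l (Suc m) j = half_sign l m i" if "l < m" for l
  proof -
    have "m - l = Suc (m - Suc l)" using that by simp
    then have "j div 2 ^ (m - l) = i div 2 ^ (m - Suc l)"
      by (simp add: i_def div_mult2_eq)
    then show ?thesis using that by (simp add: half_sign_eq)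
  qed
  have i: "i < 2 ^ m" using Suc.prems by (simp add: i_def)
  \<comment> \<open>One factor \<open>2 powr (m / 2)\<close> comes from the series and one from the
    normalisation of the coefficient; together they give \<open>2 ^ m\<close>.\<close>
  have top: "2 powr (real m / 2) * fs_coeff x m i = 2 ^ m *
     (2 * x ((2 * real i + 1) / 2 ^ (m + 1)) - x (real i / 2 ^ m) - x ((real i + 1) / 2 ^ m))"
    by (simp add: fs_coeff_def powr_add [symmetric] powr_realpow flip: mult.assoc)
  have "(\<Sum>l<Suc m. 2 powr (real l / 2) * fs_coeff x l (ancestor l (Suc m) j) * half_sign l (Suc m) j)
    = (\<Sum>l<m. 2 powr (real l / 2) * fs_coeff x l (ancestor l m i) * half_sign l m i)
      + 2 powr (real m / 2) * fs_coeff x m i * half_sign m (Suc m) j"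
    by (simp add: anc sgn) (simp add: ancestor_def)
  then have "x 1 - x 0 + (\<Sum>l<Suc m. 2 powr (real l / 2) * fs_coeff x l (ancestor l (Suc m) j) * half_sign l (Suc m) j)
    = 2 ^ m * (x (real (Suc i) / 2 ^ m) - x (real i / 2 ^ m))
      + 2 powr (real m / 2) * fs_coeff x m i * half_sign m (Suc m) j"
    using Suc.IH[OF i] by simp
  also have "\<dots> = 2 ^ Suc m * (x (real (Suc j) / 2 ^ Suc m) - x (real j / 2 ^ Suc m))"
  proof (cases "even j")
    case True
    then have "j = 2 * i" by (simp add: i_def)
    then have "real j / 2 ^ Suc m = real i / 2 ^ m" 
        "real (Suc j) / 2 ^ Suc m = (2 * real i + 1) / 2 ^ (m + 1)" by (simp_all add: add.commute)
    then show ?thesis using True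
      unfolding top by (simp add: half_sign_eq algebra_simps)
  next
    case False
    then have "j = 2 * i + 1" by (simp add: i_def)
    then have "real (Suc j) / 2 ^ Suc m = real (Suc i) / 2 ^ m" 
        "real j / 2 ^ Suc m = (2 * real i + 1) / 2 ^ (m + 1)" by (simp_all add: field_simps)
    then show ?thesis using False
      unfolding top by (simp add: half_sign_eq algebra_simps)
  qed
  finally show ?case .
qed

text \<open>The slope contributes a factor \<open>2 ^ m\<close>, and the exponents
  \<open>- m * (1 - 1 / p)\<close> and \<open>m\<close> add up to \<open>m / p\<close>.\<close>

lemma fs_Z_eq:
  assumes "j < 2 ^ m"
  shows "fs_Z p (x 1 - x 0) (fs_coeff x) m j =
    2 powr (real m / p) * (x (real (Suc j) / 2 ^ m) - x (real j / 2 ^ m))"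
proof -
  have "- real m * (1 - 1 / p) + real m = real m / p"
    by (simp add: field_simps)
  then have "2 powr (- real m * (1 - 1 / p)) * 2 ^ m = 2 powr (real m / p)"
    by (metis powr_add powr_realpow zero_less_numeral)
  then show ?thesis
    unfolding fs_Z_def faber_schauder_slope[OF assms] by (simp only: mult.assoc [symmetric])
qed

lemma block_start_le: "r < b \<Longrightarrow> block_start b r j \<le> j"
proof -
  assume "r < b"
  have "int b * ((int j - int r) div int b) \<le> int j - int r"
    using \<open>r < b\<close> mult_div_mod_eq[of "int b" "int j - int r"]
      pos_mod_sign[of "int b" "int j - int r"] by linarith
  then show ?thesis by (simp add: block_start_def)
qed

text \<open>The increments telescope from the start of the block. The case \<open>j = 2 ^ m\<close>
  is covered since only cells below \<open>j\<close> are summed.\<close>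

lemma fs_P_eq:
  assumes "j \<le> 2 ^ m" "r < b"
  shows "fs_P p (x 1 - x 0) (fs_coeff x) b r m j =
    2 powr (real m / p) * (x (real j / 2 ^ m) - x (real (block_start b r j) / 2 ^ m))"
proof -
  have "fs_P p (x 1 - x 0) (fs_coeff x) b r m j =
      (\<Sum>i = block_start b r j..<j. 2 powr (real m / p) * (x (real (Suc i) / 2 ^ m) - x (real i / 2 ^ m)))"
    unfolding fs_P_def using assms by (intro sum.cong) (auto simp: fs_Z_eq)
  also have "\<dots> = 2 powr (real m / p) * (x (real j / 2 ^ m) - x (real (block_start b r j) / 2 ^ m))"
    using sum_Suc_diff'[OF block_start_le[OF assms(2)], of "\<lambda>i. x (real i / 2 ^ m)"]
    by (simp add: sum_distrib_left [symmetric])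
  finally show ?thesis .
qed

lemma abs_powr_scale:
  assumes "p \<noteq> 0"
  shows "\<bar>2 powr (real m / p) * d\<bar> powr p = 2 ^ m * \<bar>d\<bar> powr p"
  using assms by (simp add: abs_mult powr_mult powr_powr powr_realpow)

text \<open>The cross term is homogeneous of degree \<open>p\<close>, and the \<open>p\<close>-th
  power of the scale is \<open>2 ^ m\<close>. This factor cancels the weight in (iii).\<close>

lemma cross_term_scale:
  assumes "p \<noteq> 0"
  shows "cross_term p (2 powr (real m / p) * u) (2 powr (real m / p) * v) = 2 ^ m * cross_term p u v"
  unfolding cross_term_def distrib_left [symmetric] abs_powr_scale[OF assms] right_diff_distrib ..

lemma fs_A_dyadic_eq:
  assumes "p \<noteq> 0" "k \<le> 2 ^ m"
  shows "fs_A_dyadic p (x 1 - x 0) (fs_coeff x) m k =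
    (\<Sum>j<k. \<bar>x (real (Suc j) / 2 ^ m) - x (real j / 2 ^ m)\<bar> powr p)"
proof -
  have "(\<Sum>j<k. \<bar>fs_Z p (x 1 - x 0) (fs_coeff x) m j\<bar> powr p) =
     (\<Sum>j<k. 2 ^ m * \<bar>x (real (Suc j) / 2 ^ m) - x (real j / 2 ^ m)\<bar> powr p)"
    using assms by (intro sum.cong refl) (auto simp: fs_Z_eq abs_powr_scale)
  then show ?thesis by (simp add: fs_A_dyadic_def sum_distrib_left [symmetric])
qed

subsection \<open>Variation sums along shifted grids\<close>

text \<open>Clamped grid points may coincide, whereas \<open>p_sum\<close> enumerates a set. A
  repeated point only adds a zero increment, and \<open>0 powr p = 0\<close>, so summing over
  indices gives the same value.\<close>

lemma p_sum_mono_image: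
  fixes g :: "nat \<Rightarrow> real"
  assumes "mono g"
  shows "p_sum p (g ` {..K}) x t = (\<Sum>i<K. \<bar>x (min (g (Suc i)) t) - x (min (g i) t)\<bar> powr p)"
proof (induction K)
  case 0
  then show ?case by (simp add: p_sum_def)
next
  case (Suc K)
  define S where "S = g ` {..K}"
  have S: "finite S" "S \<noteq> {}" by (auto simp: S_def)
  have le: "s \<le> g K" if "s \<in> S" for s
    using that assms by (auto simp: S_def mono_def)
  have ins: "g ` {..Suc K} = insert (g (Suc K)) S" by (auto simp: S_def atMost_Suc)
  show ?case
  proof (cases "g (Suc K) = g K")
    case True
    then have "g ` {..Suc K} = S" unfolding ins by (auto simp: S_def)
    then show ?thesis using Suc True by (simp add: S_def)
  next
    case False
    then have less: "g K < g (Suc K)" using assms by (simp add: mono_def order_less_le)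
    define u where "u = sorted_list_of_set S"
    have u: "sorted u" "distinct u" "set u = S" "length u = card S"
      using S by (simp_all add: u_def)
    have ne: "card S > 0" using S by (simp add: card_gt_0_iff)
    have new: "g (Suc K) \<notin> S" using le less by force
    have "sorted (u @ [g (Suc K)])" "distinct (u @ [g (Suc K)])"
      using u new le less by (force simp: sorted_append)+
    \<comment> \<open>A sorted list without repetitions is determined by its set, so the new largest
      point is simply appended.\<close>
    then have "sorted_list_of_set (insert (g (Suc K)) S) = u @ [g (Suc K)]"
      using sorted_list_of_set.idem_if_sorted_distinct[of "u @ [g (Suc K)]"] u(3) by simp
    moreover have last: "u ! (card S - 1) = g K"
    proof -
      have "g K \<in> set u" using u by (auto simp: S_def)
      then obtain i where i: "i < length u" "u ! i = g K" by (auto simp: in_set_conv_nth)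
      then have "g K \<le> u ! (card S - 1)"
        using u ne sorted_nth_mono[OF u(1), of i "card S - 1"] by simp
      moreover have "u ! (card S - 1) \<in> S" using u ne by (metis diff_less nth_mem zero_less_one)
      ultimately show ?thesis using le by (meson antisym)
    qed
    ultimately have "p_sum p (g ` {..Suc K}) x t =
        (\<Sum>i<card S. \<bar>x (min ((u @ [g (Suc K)]) ! Suc i) t) - x (min ((u @ [g (Suc K)]) ! i) t)\<bar> powr p)"
      unfolding p_sum_def ins Let_def using new S by simp
    also have "\<dots> = (\<Sum>i<card S - 1. \<bar>x (min (u ! Suc i) t) - x (min (u ! i) t)\<bar> powr p)
        + \<bar>x (min (g (Suc K)) t) - x (min (g K) t)\<bar> powr p"
    proof -
      obtain n where n: "card S = Suc n" using ne by (cases "card S") auto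
      show ?thesis using last u(4) unfolding n by (simp add: nth_append)
    qed
    also have "(\<Sum>i<card S - 1. \<bar>x (min (u ! Suc i) t) - x (min (u ! i) t)\<bar> powr p) = p_sum p S x t"
      by (simp add: p_sum_def u_def Let_def)
    finally show ?thesis using Suc by (simp add: S_def)
  qed
qed

text \<open>The index is shifted by one: index 0 stands for \<open>c - l < 0\<close> and is clamped
  to 0, while the condition on \<open>K\<close> makes the last point clamp to 1. One
  \<open>K\<close> then serves for all nearby \<open>l\<close> and \<open>c\<close>, although the
  number of interior points may vary.\<close>

lemma shifted_grid_eq_image:
  assumes "0 < l" "0 \<le> c" "c < l" "1 \<le> c + (real K - 1) * l"
  shows "shifted_grid l c = (\<lambda>i. max 0 (min 1 (c + (real i - 1) * l))) ` {..K}"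
    (is "_ = ?g ` _")
proof (intro equalityI subsetI)
  fix s assume "s \<in> shifted_grid l c"
  then consider "s = 0" | "s = 1" | k :: int where "s = c + real_of_int k * l" "0 < s" "s < 1"
    unfolding shifted_grid_def by blast
  then show "s \<in> ?g ` {..K}"
  proof cases
    case 1
    have "s = ?g 0" using 1 assms by simp
    then show ?thesis by blast
  next
    case 2
    have "s = ?g K" using 2 assms by simp
    then show ?thesis by blast
  next
    case (3 k)
    \<comment> \<open>A negative \<open>k\<close> would put \<open>s\<close> at or below
      \<open>c - l < 0\<close>.\<close>
    have "k \<ge> 0"
    proof (rule ccontr)
      assume "\<not> k \<ge> 0"
      then have "real_of_int k * l \<le> - 1 * l"
        using assms by (intro mult_right_mono) auto
      then show False using 3 assms by simp
    qed
    then have k: "real (nat (k + 1)) - 1 = real_of_int k" by simp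
    then have "s = ?g (nat (k + 1))" using 3 by simp
    moreover have "nat (k + 1) \<le> K"
    proof -
      have "real_of_int k * l < (real K - 1) * l" using 3 assms by linarith
      then have "real (nat (k + 1)) < real K" using k assms by simp
      then show ?thesis by simp
    qed
    ultimately show ?thesis by blast
  qed
next
  fix s assume "s \<in> ?g ` {..K}"
  then obtain i where s: "s = ?g i" by blast
  have "s = 0 \<or> s = 1 \<or> (\<exists>k::int. s = c + real_of_int k * l \<and> 0 < s \<and> s < 1)"
  proof (cases "0 < s \<and> s < 1")
    case True
    then have "s = c + real_of_int (int i - 1) * l" using s by (auto simp: max_def min_def split: if_splits)
    then show ?thesis using True by blast
  next
    case False
    then show ?thesis using s by (auto simp: max_def min_def split: if_splits)
  qed
  then show "s \<in> shifted_grid l c" unfolding shifted_grid_def by blast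
qed

text \<open>Clamping to the unit interval and then stopping at \<open>t\<close> is the same as
  clamping to the interval from 0 to \<open>t\<close>.\<close>

lemma p_sum_shifted_grid:
  assumes "0 < l" "0 \<le> c" "c < l" "1 \<le> c + (real K - 1) * l" "0 \<le> t" "t \<le> 1"
  shows "p_sum p (shifted_grid l c) x t =
    (\<Sum>i<K. \<bar>x (max 0 (min t (c + real i * l))) - x (max 0 (min t (c + (real i - 1) * l)))\<bar> powr p)"
proof -
  have "mono (\<lambda>i. max 0 (min 1 (c + (real i - 1) * l)))"
    using assms by (intro monoI max.mono min.mono add_mono mult_right_mono) auto
  moreover have "min (max 0 (min 1 u)) t = max 0 (min t u)" for u
    using assms by (auto simp: max_def min_def)
  ultimately show ?thesis
    unfolding shifted_grid_eq_image[OF assms(1-4)]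
    by (simp add: p_sum_mono_image)
qed

text \<open>With a common number \<open>K\<close> of terms, the variation sum is a finite sum of
  continuous functions of mesh, shift and stopping time. Grid points entering or leaving the unit
  interval cause no jump, because they are clamped.\<close>

lemma p_sum_shifted_grid_tendsto:
  assumes x: "continuous_on {0..1} x" and "0 < p" "0 < l" "0 \<le> c" "c < l" "t \<in> {0..1}"
    and l': "l' \<longlonglongrightarrow> l" and c': "c' \<longlonglongrightarrow> c" and t': "t' \<longlonglongrightarrow> t"
    and "\<And>n. 0 \<le> c' n" and "\<And>n. t' n \<in> {0..1}"
  shows "(\<lambda>n. p_sum p (shifted_grid (l' n) (c' n)) x (t' n))
    \<longlonglongrightarrow> p_sum p (shifted_grid l c) x t"
proof -
  define S where "S l c t K =
      (\<Sum>i<K. \<bar>x (max 0 (min t (c + real i * l))) - x (max 0 (min t (c + (real i - 1) * l)))\<bar> powr p)"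
    for l c t and K :: nat
  \<comment> \<open>The inequality is strict so that it persists for \<open>l' n\<close> and
    \<open>c' n\<close> with large \<open>n\<close>.\<close>
  obtain K :: nat where K: "1 < c + (real K - 1) * l"
  proof -
    obtain n :: nat where "2 + l < real n * l" using \<open>0 < l\<close> ex_less_of_nat_mult by blast
    then have "1 < c + (real n - 1) * l" using assms by (simp add: algebra_simps)
    then show ?thesis by (rule that)
  qed
  have "\<forall>\<^sub>F n in sequentially. 1 < c' n + (real K - 1) * l' n"
    by (rule order_tendstoD(1)[OF _ K]) (intro tendsto_intros l' c')
  moreover have "\<forall>\<^sub>F n in sequentially. 0 < l' n"
    by (rule order_tendstoD(1)[OF l' \<open>0 < l\<close>])
  moreover have "\<forall>\<^sub>F n in sequentially. 0 < l' n - c' n"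
    by (rule order_tendstoD(1)[of _ "l - c"]) (use assms in \<open>auto intro: tendsto_intros\<close>)
  ultimately have "\<forall>\<^sub>F n in sequentially.
      S (l' n) (c' n) (t' n) K = p_sum p (shifted_grid (l' n) (c' n)) x (t' n)"
  proof eventually_elim
    case (elim n)
    then show ?case using assms(10)[of n] assms(11)[of n]
      by (subst p_sum_shifted_grid[of _ _ K]) (auto simp: S_def)
  qed
  moreover have "(\<lambda>n. S (l' n) (c' n) (t' n) K) \<longlonglongrightarrow> S l c t K"
  proof -
    have clip: "(\<lambda>n. x (max 0 (min (t' n) (c' n + q * l' n)))) \<longlonglongrightarrow> x (max 0 (min t (c + q * l)))" for q
      by (rule continuous_on_tendsto_compose[OF x])
         (use assms in \<open>auto intro!: tendsto_max tendsto_min tendsto_intros simp: le_max_iff_disj min_le_iff_disj\<close>)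
    \<comment> \<open>Increments may tend to 0, where continuity of the power rests on
      \<open>0 < p\<close>.\<close>
    show ?thesis unfolding S_def
      by (intro tendsto_sum tendsto_powr' tendsto_rabs tendsto_diff clip tendsto_const) (use assms in auto)
  qed
  moreover have "S l c t K = p_sum p (shifted_grid l c) x t"
    using assms K by (subst p_sum_shifted_grid[of _ _ K]) (auto simp: S_def)
  ultimately show ?thesis by (simp add: tendsto_cong)
qed

section \<open>Block cross terms as differences of stopped variation sums\<close>

text \<open>Both times lie in cell \<open>i\<close>. Earlier cells are complete at either time and
  later ones have not begun, so only the \<open>i\<close>-th summand changes.\<close>

lemma stopped_power_sum_increment:
  fixes g :: "nat \<Rightarrow> real"
  assumes "mono g" "i < K" "g i \<le> s" "s \<le> t" "t \<le> g (Suc i)"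
  shows "(\<Sum>k<K. \<bar>x (min (g (Suc k)) t) - x (min (g k) t)\<bar> powr p)
    - (\<Sum>k<K. \<bar>x (min (g (Suc k)) s) - x (min (g k) s)\<bar> powr p)
    = \<bar>x t - x (g i)\<bar> powr p - \<bar>x s - x (g i)\<bar> powr p"
proof -
  define f where "f u k = \<bar>x (min (g (Suc k)) u) - x (min (g k) u)\<bar> powr p" for u k
  have same: "f t k = f s k" if "k \<noteq> i" for k
  proof (cases "k < i")
    case True
    then have "g (Suc k) \<le> g i" "g k \<le> g i" using \<open>mono g\<close> by (auto simp: mono_def)
    then show ?thesis using assms by (simp add: f_def)
  next
    case False
    then have "g (Suc i) \<le> g k" "g (Suc i) \<le> g (Suc k)" using that \<open>mono g\<close> by (auto simp: mono_def)
    then have "min (g k) u = u" "min (g (Suc k)) u = u" if "u \<le> t" for u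
      using assms that by linarith+
    then show ?thesis using assms by (simp add: f_def)
  qed
  have "sum (f u) {..<K} = f u i + sum (f u) ({..<K} - {i})" for u
    using assms by (intro sum.remove) auto
  moreover have "sum (f t) ({..<K} - {i}) = sum (f s) ({..<K} - {i})"
    by (intro sum.cong) (auto simp: same)
  ultimately have "sum (f t) {..<K} - sum (f s) {..<K} = f t i - f s i" by simp
  then show ?thesis using assms by (simp add: f_def)
qed

text \<open>For \<open>j < r\<close> the integer quotient is at most -1 and
  \<open>r - b < 0\<close>, so the maximum yields 0: the incomplete first block starts at the
  origin. Otherwise integer and natural division agree.\<close>

lemma block_start_eq:
  assumes "r < b"
  shows "block_start b r j = (if j < r then 0 else r + b * ((j - r) div b))"
proof (cases "j < r")
  case True
  have "(int j - int r) div int b \<le> - 1"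
    using True assms pos_imp_zdiv_neg_iff[of "int b" "int j - int r"] by simp
  then have "int b * ((int j - int r) div int b) \<le> int b * - 1"
    by (intro mult_left_mono) auto
  then show ?thesis using True assms by (simp add: block_start_def)
next
  case False
  then have "(int j - int r) div int b = int ((j - r) div b)"
    by (simp add: of_nat_diff zdiv_int)
  then have "int r + int b * ((int j - int r) div int b) = int (r + b * ((j - r) div b))" by simp
  then show ?thesis using False unfolding block_start_def by (simp del: of_nat_add of_nat_mult)
qed

text \<open>Consecutive dyadic points lie in one cell of the coarse grid, whose left end is the
  block start. After scaling, the first two powers in the cross term are thus the increment of the
  stopped sum \<open>V\<close>, and the third is the increment of \<open>A_m\<close>. Summation over
  \<open>j\<close> telescopes.\<close>

lemma block_cross_sum_eq:
  fixes x :: "real \<Rightarrow> real"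
  assumes "p \<noteq> 0" "r < b" "b \<le> 2 ^ m" "k \<le> 2 ^ m"
  defines "V \<equiv> p_sum p (shifted_grid (real b / 2 ^ m) (real r / 2 ^ m)) x"
  shows "(\<Sum>j<k. cross_term p (fs_P p (x 1 - x 0) (fs_coeff x) b r m j)
      (fs_Z p (x 1 - x 0) (fs_coeff x) m j)) / 2 ^ m
    = V (real k / 2 ^ m) - fs_A_dyadic p (x 1 - x 0) (fs_coeff x) m k"
proof -
  define X where "X j = x (real j / 2 ^ m)" for j
  define g where "g i = max 0 (min 1 (real r / 2 ^ m + (real i - 1) * (real b / 2 ^ m)))" for i :: nat
  have b: "b > 0" using assms by simp
  \<comment> \<open>Large enough to reach 1 even for \<open>b = 1\<close>, and larger than every
    cell index \<open>i\<close> used below.\<close>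
  define K :: nat where "K = 2 ^ m + 2"
  have K: "1 \<le> real r / 2 ^ m + (real K - 1) * (real b / 2 ^ m)"
  proof -
    have "1 \<le> (real K - 1) / 2 ^ m * 1" by (simp add: K_def)
    also have "(real K - 1) / 2 ^ m * 1 \<le> (real K - 1) / 2 ^ m * real b"
      using b by (intro mult_left_mono) (auto simp: K_def)
    finally have "1 \<le> (real K - 1) * (real b / 2 ^ m)" by simp
    moreover have "0 \<le> real r / 2 ^ m" by simp
    ultimately show ?thesis by linarith
  qed
  have mono: "mono g" unfolding g_def
    by (intro monoI max.mono min.mono add_mono mult_right_mono) auto
  have V: "V t = (\<Sum>i<K. \<bar>x (min (g (Suc i)) t) - x (min (g i) t)\<bar> powr p)" for t
    unfolding V_def using p_sum_mono_image[OF mono, of p K x t] K assms(2) b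
    by (subst shifted_grid_eq_image[of _ _ K]) (auto simp: g_def divide_strict_right_mono)
  have step: "V (real (Suc j) / 2 ^ m) - V (real j / 2 ^ m)
      = \<bar>X (Suc j) - X (block_start b r j)\<bar> powr p - \<bar>X j - X (block_start b r j)\<bar> powr p"
    if j: "j < 2 ^ m" for j
  proof -
    \<comment> \<open>Cell 0 of \<open>g\<close> is the incomplete block before \<open>r\<close>;
      the block starting at \<open>r + q * b\<close> has index \<open>q + 1\<close>, by the index
      shift in \<open>g\<close>.\<close>
    define i where "i = (if j < r then 0 else Suc ((j - r) div b))"
    have gi: "g i = real (block_start b r j) / 2 ^ m"
      and gSi: "real (Suc j) / 2 ^ m \<le> g (Suc i)"
      and iK: "i < K"
    proof -
      have Sj: "real (Suc j) / 2 ^ m \<le> 1"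
        using j by (simp add: Suc_le_eq flip: of_nat_Suc)
      show "g i = real (block_start b r j) / 2 ^ m"
      proof (cases "j < r")
        case True
        have "real r / 2 ^ m + (real i - 1) * (real b / 2 ^ m) \<le> 0"
          using True assms by (simp add: i_def divide_right_mono)
        then show ?thesis using True assms by (simp add: g_def block_start_eq min_def)
      next
        case False
        have "real (block_start b r j) / 2 ^ m \<le> 1"
          using block_start_le[OF assms(2), of j]
          by (intro order_trans[OF divide_right_mono Sj]) simp_all
        then show ?thesis using assms b False by (simp add: g_def i_def block_start_eq add_divide_distrib mult.commute)
      qed
      show "real (Suc j) / 2 ^ m \<le> g (Suc i)"
      proof -
        have "Suc j \<le> r + i * b"
        proof (cases "j < r")
          case False
          have "j - r < Suc ((j - r) div b) * b" using b
            by (metis dividend_less_div_times mult_Suc)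
          then show ?thesis using False by (simp add: i_def)
        qed (simp add: i_def)
        then have "real (Suc j) \<le> real r + real i * real b"
          by (metis of_nat_add of_nat_le_iff of_nat_mult)
        then have "real (Suc j) / 2 ^ m \<le> real r / 2 ^ m + real i * (real b / 2 ^ m)"
          by (simp add: divide_right_mono flip: add_divide_distrib)
        then show ?thesis using Sj by (simp add: g_def)
      qed
      have "(j - r) div b \<le> j" by (rule order_trans[OF div_le_dividend]) simp
      then show "i < K" using j by (simp add: i_def K_def)
    qed
    show ?thesis
      using stopped_power_sum_increment[OF mono iK _ _ gSi, of "real j / 2 ^ m" x p] block_start_le[OF assms(2), of j]
      by (simp add: V gi X_def divide_right_mono)
  qed
  have "(\<Sum>j<k. cross_term p (fs_P p (x 1 - x 0) (fs_coeff x) b r m j)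
      (fs_Z p (x 1 - x 0) (fs_coeff x) m j))
    = (\<Sum>j<k. 2 ^ m * ((V (real (Suc j) / 2 ^ m) - V (real j / 2 ^ m)) - \<bar>X (Suc j) - X j\<bar> powr p))"
  proof (intro sum.cong refl)
    fix j assume "j \<in> {..<k}"
    then have j: "j < 2 ^ m" using assms by simp
    show "cross_term p (fs_P p (x 1 - x 0) (fs_coeff x) b r m j) (fs_Z p (x 1 - x 0) (fs_coeff x) m j)
      = 2 ^ m * ((V (real (Suc j) / 2 ^ m) - V (real j / 2 ^ m)) - \<bar>X (Suc j) - X j\<bar> powr p)"
      unfolding step[OF j] fs_P_eq[OF less_imp_le[OF j] assms(2)] fs_Z_eq[OF j] cross_term_scale[OF assms(1)]
      by (simp add: cross_term_def X_def)
  qed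
  also have "\<dots> = 2 ^ m * (V (real k / 2 ^ m) - V 0 - (\<Sum>j<k. \<bar>X (Suc j) - X j\<bar> powr p))"
    using sum_lessThan_telescope[of "\<lambda>j. V (real j / 2 ^ m)" k]
    by (simp add: sum_distrib_left [symmetric] sum_subtractf)
  \<comment> \<open>Stopped at 0, all grid points collapse to 0.\<close>
  also have "V 0 = 0"
  proof -
    have "0 \<le> g i" for i by (simp add: g_def)
    then show ?thesis by (simp add: V)
  qed
  finally show ?thesis
    using assms by (simp add: fs_A_dyadic_eq X_def)
qed

text \<open>For blocks of length 1 the sum \<open>fs_P\<close> is empty, so every cross term
  vanishes and the block identity reduces to this one.\<close>

lemma fs_A_dyadic_eq_p_sum:
  assumes "p \<noteq> 0" "k \<le> 2 ^ m"
  shows "fs_A_dyadic p (x 1 - x 0) (fs_coeff x) m k = p_sum p (shifted_grid (1 / 2 ^ m) 0) x (real k / 2 ^ m)"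
proof -
  have "fs_P p (x 1 - x 0) (fs_coeff x) 1 0 m j = 0" for j
    by (simp add: fs_P_def block_start_eq)
  then show ?thesis
    using block_cross_sum_eq[of p 0 1 m k x] assms by (simp add: cross_term_def)
qed

subsection \<open>Piecewise linear interpolation\<close>

text \<open>At the right end of a cell the floor already selects the next cell, with weight 0; both
  formulas agree there, so the closed cell is admissible.\<close>

lemma fs_A_cell:
  assumes "real k \<le> 2 ^ m * t" "2 ^ m * t \<le> real (Suc k)"
  shows "fs_A p a \<theta> m t = (real (Suc k) - 2 ^ m * t) * fs_A_dyadic p a \<theta> m k
    + (2 ^ m * t - real k) * fs_A_dyadic p a \<theta> m (Suc k)"
proof (cases "2 ^ m * t = real (Suc k)")
  case True
  then have "nat \<lfloor>2 ^ m * t\<rfloor> = Suc k" by (simp only: floor_of_nat nat_int)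
  then show ?thesis using True by (simp add: fs_A_def)
next
  case False
  then have "\<lfloor>2 ^ m * t\<rfloor> = int k"
    using assms by (intro floor_unique) auto
  then show ?thesis by (simp add: fs_A_def Let_def algebra_simps)
qed

lemma fs_A_dyadic_point: "fs_A p a \<theta> m (real k / 2 ^ m) = fs_A_dyadic p a \<theta> m k"
  by (subst fs_A_cell[of k]) auto

lemma unit_interval_cell:
  fixes t :: real
  assumes "t \<in> {0..1}" "0 < N"
  obtains k where "k < N" "real k \<le> real N * t" "real N * t \<le> real (Suc k)"
proof (cases "t = 1")
  case True
  with assms show ?thesis by (intro that[of "N - 1"]) auto
next
  case False
  define k where "k = nat \<lfloor>real N * t\<rfloor>"
  have "0 \<le> real N * t" "real N * t < real N" using assms False by auto
  then have "real k \<le> real N * t" "real N * t < real (Suc k)" "real k < real N"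
    unfolding k_def by linarith+
  then show ?thesis by (intro that[of k]) auto
qed

text \<open>A level-\<open>n\<close> cell is contained in the level-\<open>m\<close> cell with index
  \<open>k div 2 ^ (n - m)\<close>. Two interpolants can thus be compared on the cells of the finer
  level.\<close>

lemma fs_A_affine_on_finer_cell:
  assumes "m \<le> n"
  shows "\<exists>\<alpha> \<beta>. \<forall>t\<in>{real k / 2 ^ n..real (Suc k) / 2 ^ n}. fs_A p a \<theta> m t = \<alpha> + \<beta> * t"
proof -
  define q :: nat where "q = 2 ^ (n - m)"
  define j where "j = k div q"
  have q: "q > 0" by (simp add: q_def)
  have pow: "(2::real) ^ n = 2 ^ m * real q"
    using assms by (simp add: q_def flip: power_add)
  have "j * q \<le> k" by (simp add: j_def)
  moreover have "Suc k \<le> Suc j * q"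
    using dividend_less_div_times[OF q, of k] by (simp add: j_def)
  ultimately have "real (j * q) \<le> real k" "real (Suc k) \<le> real (Suc j * q)"
    by (simp_all only: of_nat_le_iff)
  then have jk: "real j * real q \<le> real k" "real (Suc k) \<le> real (Suc j) * real q"
    by (simp_all only: of_nat_mult)
  have "fs_A p a \<theta> m t = (real (Suc j) * fs_A_dyadic p a \<theta> m j - real j * fs_A_dyadic p a \<theta> m (Suc j))
      + (2 ^ m * (fs_A_dyadic p a \<theta> m (Suc j) - fs_A_dyadic p a \<theta> m j)) * t"
    if t: "t \<in> {real k / 2 ^ n..real (Suc k) / 2 ^ n}" for t
  proof -
    have "real k \<le> 2 ^ m * t * real q" "2 ^ m * t * real q \<le> real (Suc k)"
      using t q unfolding pow by (auto simp: field_simps)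
    then have "real j * real q \<le> 2 ^ m * t * real q" "2 ^ m * t * real q \<le> real (Suc j) * real q"
      using jk by linarith+
    then have "real j \<le> 2 ^ m * t" "2 ^ m * t \<le> real (Suc j)"
      using q by (simp_all only: mult_le_cancel_right_pos of_nat_0_less_iff)
    then show ?thesis by (simp add: fs_A_cell[of j] algebra_simps)
  qed
  then show ?thesis by blast
qed

lemma abs_affine_le:
  fixes u v :: real
  assumes "u \<le> t" "t \<le> v" "\<bar>\<alpha> + \<beta> * u\<bar> \<le> e" "\<bar>\<alpha> + \<beta> * v\<bar> \<le> e"
  shows "\<bar>\<alpha> + \<beta> * t\<bar> \<le> e"
proof (cases "\<beta> \<ge> 0")
  case True
  then have "\<beta> * u \<le> \<beta> * t" "\<beta> * t \<le> \<beta> * v" using assms by (auto intro: mult_left_mono)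
  then show ?thesis using assms by linarith
next
  case False
  then have "\<beta> * t \<le> \<beta> * u" "\<beta> * v \<le> \<beta> * t" using assms by (auto intro: mult_left_mono_neg)
  then show ?thesis using assms by linarith
qed

lemma dyadics_eq_image: "dyadics m = (\<lambda>j. real j / 2 ^ m) ` {..2 ^ m}"
  by (auto simp: dyadics_def)

lemma dyadics_subset: "dyadics m \<subseteq> {0..1}"
proof -
  have "real j \<le> 2 ^ m" if "j \<le> 2 ^ m" for j
    using that by (metis of_nat_le_iff of_nat_numeral of_nat_power)
  then show ?thesis by (auto simp: dyadics_eq_image)
qed

text \<open>On each cell of the finer level the difference is affine, so its absolute value is
  largest at an endpoint, which is a dyadic point. Hence (i) controls the whole unit
  interval.\<close>

lemma fs_A_diff_le:
  assumes "\<And>s. s \<in> dyadics (max m n) \<Longrightarrow> \<bar>fs_A p a \<theta> m s - fs_A p a \<theta> n s\<bar> \<le> e" and "t \<in> {0..1}"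
  shows "\<bar>fs_A p a \<theta> m t - fs_A p a \<theta> n t\<bar> \<le> e"
proof -
  define N where "N = max m n"
  obtain k where k: "k < 2 ^ N" "real k \<le> real (2 ^ N) * t" "real (2 ^ N) * t \<le> real (Suc k)"
    using unit_interval_cell[OF assms(2), of "2 ^ N"] by auto
  define I where "I = {real k / 2 ^ N..real (Suc k) / 2 ^ N}"
  obtain \<alpha> \<beta> where 1: "\<And>s. s \<in> I \<Longrightarrow> fs_A p a \<theta> m s = \<alpha> + \<beta> * s"
    using fs_A_affine_on_finer_cell[of m N k p a \<theta>] by (auto simp: N_def I_def)
  obtain \<alpha>' \<beta>' where 2: "\<And>s. s \<in> I \<Longrightarrow> fs_A p a \<theta> n s = \<alpha>' + \<beta>' * s"
    using fs_A_affine_on_finer_cell[of n N k p a \<theta>] by (auto simp: N_def I_def)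
  have diff: "fs_A p a \<theta> m s - fs_A p a \<theta> n s = (\<alpha> - \<alpha>') + (\<beta> - \<beta>') * s" if "s \<in> I" for s
    using 1[OF that] 2[OF that] by (simp add: algebra_simps)
  have ends: "real k / 2 ^ N \<in> I" "real (Suc k) / 2 ^ N \<in> I"
    by (auto simp: I_def divide_right_mono)
  have t: "real k / 2 ^ N \<le> t" "t \<le> real (Suc k) / 2 ^ N"
    using k by (auto simp: field_simps)
  have "real k / 2 ^ N \<in> dyadics N" "real (Suc k) / 2 ^ N \<in> dyadics N"
    unfolding dyadics_eq_image using k by (intro imageI; simp)+
  then have "\<bar>(\<alpha> - \<alpha>') + (\<beta> - \<beta>') * (real k / 2 ^ N)\<bar> \<le> e"
    "\<bar>(\<alpha> - \<alpha>') + (\<beta> - \<beta>') * (real (Suc k) / 2 ^ N)\<bar> \<le> e"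
    using assms(1) ends by (simp_all only: N_def [symmetric] diff [symmetric])
  from abs_affine_le[OF t this] show ?thesis using t by (subst diff) (auto simp: I_def)
qed

lemma continuous_on_fs_A: "continuous_on {0..1} (fs_A p a \<theta> m)"
proof -
  define I where "I k = {real k / 2 ^ m..real (Suc k) / 2 ^ m}" for k
  have "continuous_on (I k) (fs_A p a \<theta> m)" for k
  proof -
    obtain \<alpha> \<beta> where "\<And>s. s \<in> I k \<Longrightarrow> fs_A p a \<theta> m s = \<alpha> + \<beta> * s"
      using fs_A_affine_on_finer_cell[of m m k p a \<theta>] by (auto simp: I_def)
    then have "continuous_on (I k) (fs_A p a \<theta> m) \<longleftrightarrow> continuous_on (I k) (\<lambda>s. \<alpha> + \<beta> * s)"
      by (intro continuous_on_cong) auto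
    then show ?thesis by (auto intro: continuous_intros)
  qed
  then have "continuous_on (\<Union>k\<in>{..<2 ^ m}. I k) (fs_A p a \<theta> m)"
    by (intro continuous_on_closed_Union) (auto simp: I_def)
  moreover have "{0..1} \<subseteq> (\<Union>k\<in>{..<2 ^ m}. I k)"
  proof
    fix t :: real assume "t \<in> {0..1}"
    then obtain k where "k < 2 ^ m" "real k \<le> real (2 ^ m) * t" "real (2 ^ m) * t \<le> real (Suc k)"
      using unit_interval_cell[of t "2 ^ m"] by auto
    then show "t \<in> (\<Union>k\<in>{..<2 ^ m}. I k)"
      by (intro UN_I[of k]) (auto simp: I_def field_simps)
  qed
  ultimately show ?thesis by (rule continuous_on_subset)
qed

subsection \<open>The conditions in terms of real bounds\<close>

text \<open>Positive reals are cofinal towards 0 among positive extended reals, so convergence of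
  the suprema can be tested with real bounds.\<close>

lemma tendsto_0_ennreal_iff:
  fixes f :: "'a \<Rightarrow> ennreal"
  shows "(f \<longlongrightarrow> 0) F \<longleftrightarrow> (\<forall>e>0. \<forall>\<^sub>F n in F. f n \<le> ennreal e)"
proof
  assume "(f \<longlongrightarrow> 0) F"
  then have "\<forall>\<^sub>F n in F. f n < ennreal e" if "e > 0" for e
    using that by (intro order_tendstoD(2)) auto
  then show "\<forall>e>0. \<forall>\<^sub>F n in F. f n \<le> ennreal e"
    by (meson eventually_mono less_imp_le)
next
  assume *: "\<forall>e>0. \<forall>\<^sub>F n in F. f n \<le> ennreal e"
  show "(f \<longlongrightarrow> 0) F"
  proof (rule order_tendstoI)
    fix y :: ennreal assume "0 < y"
    \<comment> \<open>\<open>y\<close> may be infinite; an intermediate value is finite and hence a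
      real.\<close>
    then obtain z where z: "0 < z" "z < y" using dense by blast
    then obtain e where "z = ennreal e" "0 \<le> e" by (cases z) auto
    with z have "e > 0" "ennreal e < y" by (auto simp: order_less_le)
    with * show "\<forall>\<^sub>F n in F. f n < y" by (auto elim!: eventually_mono)
  qed simp
qed

text \<open>The supremum runs over all meshes up to \<open>\<delta>\<close> and so grows with
  \<open>\<delta>\<close>; a bound near 0 is the same as a bound for a single
  \<open>\<delta>\<close>.\<close>

lemma is_rough_variation_limit_iff:
  "((\<lambda>\<delta>. SUP l\<in>{0<..\<delta>}. SUP c\<in>{0..<l}. SUP t\<in>{0..1}. ennreal \<bar>D l c t\<bar>) \<longlongrightarrow> 0) (at_right (0::real))
    \<longleftrightarrow> (\<forall>e>0. \<exists>\<delta>>0. \<forall>l c t. 0 < l \<longrightarrow> l \<le> \<delta> \<longrightarrow> 0 \<le> c \<longrightarrow> c < l \<longrightarrow> t \<in> {0..1::real} \<longrightarrow> \<bar>D l c t\<bar> \<le> e)"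
proof -
  have "(\<forall>\<^sub>F \<delta> in at_right 0. (SUP l\<in>{0<..\<delta>}. SUP c\<in>{0..<l}. SUP t\<in>{0..1}. ennreal \<bar>D l c t\<bar>) \<le> ennreal e)
    \<longleftrightarrow> (\<exists>\<delta>>0. \<forall>l c t. 0 < l \<longrightarrow> l \<le> \<delta> \<longrightarrow> 0 \<le> c \<longrightarrow> c < l \<longrightarrow> t \<in> {0..1} \<longrightarrow> \<bar>D l c t\<bar> \<le> e)"
    (is "?l \<longleftrightarrow> ?r") if "e > 0" for e
  proof
    assume ?l
    then obtain b where b: "b > 0" "\<And>\<delta>. 0 < \<delta> \<Longrightarrow> \<delta> < b \<Longrightarrow>
        (SUP l\<in>{0<..\<delta>}. SUP c\<in>{0..<l}. SUP t\<in>{0..1}. ennreal \<bar>D l c t\<bar>) \<le> ennreal e"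
      by (auto simp: eventually_at_right_field)
    \<comment> \<open>The filter gives bounds only strictly below \<open>b\<close>, hence the choice
      \<open>b / 2\<close>.\<close>
    show ?r
      using b(1) b(2)[of "b / 2"] that
      by (intro exI[of _ "b / 2"]) (auto simp: SUP_le_iff)
  next
    assume ?r
    then show ?l using that
      by (auto simp: eventually_at_right_field SUP_le_iff ennreal_le_iff)
  qed
  then show ?thesis unfolding tendsto_0_ennreal_iff by simp
qed

lemma dyadic_cauchy_iff:
  "dyadic_cauchy p a \<theta> \<longleftrightarrow> (\<forall>e>0. \<exists>M. \<forall>m\<ge>M. \<forall>n\<ge>M. \<forall>s\<in>dyadics (max m n).
    \<bar>fs_A p a \<theta> m s - fs_A p a \<theta> n s\<bar> \<le> e)"
proof -
  have fin: "finite (dyadics m)" "dyadics m \<noteq> {}" for m by (auto simp: dyadics_eq_image)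
  have "(\<forall>\<^sub>F M in sequentially. (SUP m\<in>{M..}. SUP n\<in>{M..}.
        ennreal (MAX s\<in>dyadics (max m n). \<bar>fs_A p a \<theta> m s - fs_A p a \<theta> n s\<bar>)) \<le> ennreal e)
    \<longleftrightarrow> (\<exists>M. \<forall>m\<ge>M. \<forall>n\<ge>M. \<forall>s\<in>dyadics (max m n). \<bar>fs_A p a \<theta> m s - fs_A p a \<theta> n s\<bar> \<le> e)"
    if "e > 0" for e
  proof -
    have "ennreal (Max ((\<lambda>s. \<bar>fs_A p a \<theta> m s - fs_A p a \<theta> n s\<bar>) ` dyadics N)) \<le> ennreal e
        \<longleftrightarrow> (\<forall>s\<in>dyadics N. \<bar>fs_A p a \<theta> m s - fs_A p a \<theta> n s\<bar> \<le> e)" for m n N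
      using fin[of N] that by simp
    then show ?thesis
      unfolding eventually_sequentially SUP_le_iff atLeast_iff Ball_def[of "{_..}"]
      by (meson order_trans order_refl)
  qed
  then show ?thesis unfolding dyadic_cauchy_def tendsto_0_ennreal_iff by simp
qed

text \<open>A limsup below \<open>e\<close> gives an eventual bound by \<open>e\<close>, and an
  eventual bound passes to the limsup. At \<open>s = k / 2 ^ m\<close> the sum runs over
  \<open>j < k\<close>, so suprema over \<open>s\<close> become bounds on partial sums.\<close>

lemma block_cancellation_iff:
  "block_cancellation p a \<theta> \<longleftrightarrow> (\<forall>e>0. \<exists>L0. \<forall>L\<ge>L0. \<forall>\<^sub>F m in sequentially.
    \<forall>b\<in>{L..2 ^ m div L}. \<forall>r<b. \<forall>k\<le>2 ^ m.
      \<bar>(\<Sum>j<k. cross_term p (fs_P p a \<theta> b r m j) (fs_Z p a \<theta> m j)) / 2 ^ m\<bar> \<le> e)"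
proof -
  define S where "S L m = (SUP b\<in>{L..2 ^ m div L}. SUP r\<in>{..<b}. SUP s\<in>dyadics m.
        ennreal \<bar>(\<Sum>j | real j / 2 ^ m < s.
          cross_term p (fs_P p a \<theta> b r m j) (fs_Z p a \<theta> m j)) / 2 ^ m\<bar>)" for L m
  have set: "{j. real j / 2 ^ m < real k / 2 ^ m} = {..<k}" for k m
    by (auto simp: divide_less_cancel)
  have S: "S L m \<le> ennreal e \<longleftrightarrow> (\<forall>b\<in>{L..2 ^ m div L}. \<forall>r<b. \<forall>k\<le>2 ^ m.
      \<bar>(\<Sum>j<k. cross_term p (fs_P p a \<theta> b r m j) (fs_Z p a \<theta> m j)) / 2 ^ m\<bar> \<le> e)"
    if "e > 0" for L m e
    unfolding S_def SUP_le_iff dyadics_eq_image using that by (simp add: SUP_le_iff set) (simp add: Ball_def)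
  have "(\<lambda>L. limsup (S L)) \<longlonglongrightarrow> 0 \<longleftrightarrow>
      (\<forall>e>0. \<exists>L0. \<forall>L\<ge>L0. \<forall>\<^sub>F m in sequentially. S L m \<le> ennreal e)"
  proof (intro iffI allI impI)
    fix e :: real assume "e > 0" and lim: "(\<lambda>L. limsup (S L)) \<longlonglongrightarrow> 0"
    then have "\<forall>\<^sub>F L in sequentially. limsup (S L) < ennreal e"
      by (intro order_tendstoD(2)) auto
    then obtain L0 where L0: "\<And>L. L \<ge> L0 \<Longrightarrow> limsup (S L) < ennreal e"
      by (auto simp: eventually_sequentially)
    have "\<forall>\<^sub>F m in sequentially. S L m \<le> ennreal e" if "L \<ge> L0" for L
      using Limsup_lessD[OF L0[OF that]] by (rule eventually_mono) simp
    then show "\<exists>L0. \<forall>L\<ge>L0. \<forall>\<^sub>F m in sequentially. S L m \<le> ennreal e" by blast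
  next
    assume *: "\<forall>e>0. \<exists>L0. \<forall>L\<ge>L0. \<forall>\<^sub>F m in sequentially. S L m \<le> ennreal e"
    show "(\<lambda>L. limsup (S L)) \<longlonglongrightarrow> 0"
      unfolding tendsto_0_ennreal_iff
    proof (intro allI impI)
      fix e :: real assume "e > 0"
      then obtain L0 where L0: "\<And>L. L \<ge> L0 \<Longrightarrow> \<forall>\<^sub>F m in sequentially. S L m \<le> ennreal e"
        using * by blast
      show "\<forall>\<^sub>F L in sequentially. limsup (S L) \<le> ennreal e"
        by (rule eventually_sequentiallyI[of L0], rule Limsup_bounded, rule L0)
    qed
  qed
  then show ?thesis unfolding block_cancellation_def S_def [symmetric] using S by auto
qed

text \<open>The sum in (ii) is the value of \<open>A_m\<close> at 1; once this converges, the liminf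
  is the limit.\<close>

lemma dyadic_nondegenerate_iff:
  assumes "(\<lambda>m. fs_A p a \<theta> m 1) \<longlonglongrightarrow> c"
  shows "dyadic_nondegenerate p a \<theta> \<longleftrightarrow> 0 < c"
proof -
  have "(\<Sum>j<2 ^ m. \<bar>fs_Z p a \<theta> m j\<bar> powr p) / 2 ^ m = fs_A p a \<theta> m 1" for m
    using fs_A_dyadic_point[of p a \<theta> m "2 ^ m"] by (simp add: fs_A_dyadic_def)
  moreover have "liminf (\<lambda>m. ennreal (fs_A p a \<theta> m 1)) = ennreal c"
    using assms by (intro lim_imp_Liminf tendsto_ennrealI) auto
  ultimately show ?thesis by (simp add: dyadic_nondegenerate_def)
qed

subsection \<open>Roughness and the dyadic conditions\<close>

text \<open>Triangle inequality through \<open>A (s n)\<close>. It serves for stopping times rounded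
  to dyadic points that move with the level.\<close>

lemma uniform_limit_tendsto_diagonal:
  fixes f :: "'a \<Rightarrow> 'b::topological_space \<Rightarrow> 'c::metric_space"
  assumes f: "uniform_limit X f A F" and A: "continuous_on X A"
    and s: "(s \<longlongrightarrow> t) F" "\<And>n. s n \<in> X" "t \<in> X"
  shows "((\<lambda>n. f n (s n)) \<longlongrightarrow> A t) F"
proof (rule tendstoI)
  fix e :: real assume "e > 0"
  have "((\<lambda>n. A (s n)) \<longlongrightarrow> A t) F"
    using continuous_on_tendsto_compose[OF A s(1,3)] s(2) by simp
  then have "\<forall>\<^sub>F n in F. dist (A (s n)) (A t) < e / 2" using \<open>e > 0\<close> by (intro tendstoD) auto
  moreover have "\<forall>\<^sub>F n in F. \<forall>y\<in>X. dist (f n y) (A y) < e / 2"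
    using uniform_limitD[OF f, of "e / 2"] \<open>e > 0\<close> by simp
  ultimately show "\<forall>\<^sub>F n in F. dist (f n (s n)) (A t) < e"
  proof eventually_elim
    case (elim n)
    then have "dist (f n (s n)) (A (s n)) < e / 2" using s(2) by blast
    then show ?case using elim(1) dist_triangle[of "f n (s n)" "A t" "A (s n)"] by linarith
  qed
qed

lemma dyadic_floor_tendsto:
  assumes "0 \<le> t"
  shows "(\<lambda>m. real (nat \<lfloor>2 ^ m * t\<rfloor>) / 2 ^ m) \<longlonglongrightarrow> t"
proof (rule tendsto_sandwich)
  have fl: "2 ^ m * t - 1 \<le> real (nat \<lfloor>2 ^ m * t\<rfloor>)" "real (nat \<lfloor>2 ^ m * t\<rfloor>) \<le> 2 ^ m * t" for m :: nat
    using assms by (simp; linarith)+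
  have eq: "t - (1 / 2) ^ m = (2 ^ m * t - 1) / 2 ^ m" for m
    by (simp add: field_simps power_divide)
  show "\<forall>\<^sub>F m in sequentially. t - (1 / 2) ^ m \<le> real (nat \<lfloor>2 ^ m * t\<rfloor>) / 2 ^ m"
    unfolding eq using fl(1) by (intro always_eventually allI divide_right_mono) auto
  show "\<forall>\<^sub>F m in sequentially. real (nat \<lfloor>2 ^ m * t\<rfloor>) / 2 ^ m \<le> t"
    using fl(2) by (intro always_eventually allI) (simp add: pos_divide_le_eq mult.commute)
  show "(\<lambda>m. t - (1 / 2) ^ m) \<longlonglongrightarrow> t"
    using tendsto_diff[OF tendsto_const LIMSEQ_power_zero[of "1 / 2 :: real"], of t] by simp
qed simp

section \<open>From roughness to the dyadic conditions\<close>

text \<open>At dyadic points \<open>A_m\<close> is the variation sum of mesh \<open>2^(-m)\<close>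
  and shift 0, which roughness places near \<open>A\<close>. In between, \<open>A_m\<close> is a
  convex combination of two such values, and \<open>A\<close> is uniformly continuous.\<close>

lemma uniform_limit_fs_A:
  assumes "p \<noteq> 0" and A: "is_rough_variation p x A"
  shows "uniform_limit {0..1} (fs_A p (x 1 - x 0) (fs_coeff x)) A sequentially"
proof (rule uniform_limitI)
  fix e :: real assume "e > 0"
  define f where "f = fs_A_dyadic p (x 1 - x 0) (fs_coeff x)"
  have cont: "continuous_on {0..1} A" using A by (simp add: is_rough_variation_def)
  obtain \<delta> where \<delta>: "\<delta> > 0" "\<And>l c t. 0 < l \<Longrightarrow> l \<le> \<delta> \<Longrightarrow> 0 \<le> c \<Longrightarrow> c < l \<Longrightarrow> t \<in> {0..1} \<Longrightarrow>
      \<bar>p_sum p (shifted_grid l c) x t - A t\<bar> \<le> e / 3"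
  proof -
    have "e / 3 > 0" using \<open>e > 0\<close> by simp
    with A show ?thesis
      unfolding is_rough_variation_def is_rough_variation_limit_iff using that by blast
  qed
  obtain d where d: "d > 0" "\<And>s t. s \<in> {0..1} \<Longrightarrow> t \<in> {0..1} \<Longrightarrow> \<bar>s - t\<bar> < d \<Longrightarrow> \<bar>A s - A t\<bar> < e / 3"
    using compact_uniformly_continuous[OF cont] \<open>e > 0\<close>
    unfolding uniformly_continuous_on_def dist_real_def
    by (metis compact_Icc divide_pos_pos zero_less_numeral)
  have "\<forall>\<^sub>F m in sequentially. (1 / 2) ^ m < min \<delta> d"
    using \<delta>(1) d(1) by (intro order_tendstoD(2)[OF LIMSEQ_power_zero]) auto
  then show "\<forall>\<^sub>F m in sequentially. \<forall>t\<in>{0..1}. dist (fs_A p (x 1 - x 0) (fs_coeff x) m t) (A t) < e"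
  proof (eventually_elim, intro ballI)
    fix m :: nat and t :: real
    assume m: "(1 / 2) ^ m < min \<delta> d" and t: "t \<in> {0..1}"
    then have small: "1 / 2 ^ m \<le> \<delta>" "1 / 2 ^ m < d" by (auto simp: power_divide)
    obtain k where k: "k < 2 ^ m" "real k \<le> real (2 ^ m) * t" "real (2 ^ m) * t \<le> real (Suc k)"
      using unit_interval_cell[OF t, of "2 ^ m"] by auto
    \<comment> \<open>One third of \<open>e\<close> comes from roughness at the endpoint, another
      from moving the endpoint to \<open>t\<close>.\<close>
    have near: "\<bar>f m i - A t\<bar> \<le> 2 * e / 3" if "i = k \<or> i = Suc k" for i
    proof -
      have i: "i \<le> 2 ^ m" using that k by auto
      have ii: "real i / 2 ^ m \<in> {0..1}"
        using i dyadics_subset[of m] by (auto simp: dyadics_eq_image)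
      have "f m i = p_sum p (shifted_grid (1 / 2 ^ m) 0) x (real i / 2 ^ m)"
        using assms(1) i by (simp add: f_def fs_A_dyadic_eq_p_sum)
      then have "\<bar>f m i - A (real i / 2 ^ m)\<bar> \<le> e / 3"
        using \<delta>(2)[of "1 / 2 ^ m" 0 "real i / 2 ^ m"] small ii by simp
      moreover have "\<bar>A (real i / 2 ^ m) - A t\<bar> < e / 3"
      proof (rule d(2)[OF ii t])
        have "\<bar>real i - 2 ^ m * t\<bar> \<le> 1" using k that by auto
        then have "\<bar>real i - 2 ^ m * t\<bar> / 2 ^ m \<le> 1 / 2 ^ m" by (rule divide_right_mono) simp
        moreover have "\<bar>real i - 2 ^ m * t\<bar> / 2 ^ m = \<bar>real i / 2 ^ m - t\<bar>"
        proof -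
          have "real i / 2 ^ m - t = (real i - 2 ^ m * t) / 2 ^ m" by (simp add: diff_divide_distrib)
          then show ?thesis by (simp only: abs_divide) simp
        qed
        ultimately show "\<bar>real i / 2 ^ m - t\<bar> < d" using small by linarith
      qed
      ultimately show ?thesis by linarith
    qed
    define w where "w = 2 ^ m * t - real k"
    have w: "0 \<le> w" "w \<le> 1" using k by (auto simp: w_def)
    have eq: "fs_A p (x 1 - x 0) (fs_coeff x) m t = (1 - w) * f m k + w * f m (Suc k)"
      using k by (simp add: fs_A_cell[of k] w_def f_def algebra_simps)
    have "\<bar>f m k - A t\<bar> \<le> 2 * e / 3" "\<bar>f m (Suc k) - A t\<bar> \<le> 2 * e / 3"
      by (intro near; simp)+
    then have "f m k \<le> A t + 2 * e / 3" "f m (Suc k) \<le> A t + 2 * e / 3"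
      and "- f m k \<le> 2 * e / 3 - A t" "- f m (Suc k) \<le> 2 * e / 3 - A t"
      by linarith+
    \<comment> \<open>Convexity gives the upper bound; applied to the negated values it gives the
      lower one.\<close>
    then have "(1 - w) * f m k + w * f m (Suc k) \<le> A t + 2 * e / 3"
      and "(1 - w) * (- f m k) + w * (- f m (Suc k)) \<le> 2 * e / 3 - A t"
      using w by (intro convex_bound_le; simp)+
    then show "dist (fs_A p (x 1 - x 0) (fs_coeff x) m t) (A t) < e"
      unfolding eq dist_real_def using \<open>e > 0\<close> by (simp add: abs_less_iff)
  qed
qed

text \<open>Uniform convergence of \<open>A_m\<close> to \<open>A\<close> gives (i), and with
  \<open>A 1 > 0\<close> also (ii). For (iii), the block sum is a variation sum minus
  \<open>A_m\<close>, and both are close to \<open>A\<close>.\<close>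

lemma is_rough_variation_imp_dyadic_conditions:
  assumes "p \<noteq> 0" and A: "is_rough_variation p x A"
  defines "a \<equiv> x 1 - x 0" and "\<theta> \<equiv> fs_coeff x"
  shows "dyadic_cauchy p a \<theta>" "dyadic_nondegenerate p a \<theta>" "block_cancellation p a \<theta>"
proof -
  have lim: "uniform_limit {0..1} (fs_A p a \<theta>) A sequentially"
    unfolding a_def \<theta>_def by (rule uniform_limit_fs_A[OF assms(1,2)])
  have near: "\<exists>M. \<forall>m\<ge>M. \<forall>t\<in>{0..1}. \<bar>fs_A p a \<theta> m t - A t\<bar> < e" if "e > 0" for e
    using uniform_limitD[OF lim that] by (simp add: eventually_sequentially dist_real_def)
  show "dyadic_cauchy p a \<theta>"
    unfolding dyadic_cauchy_iff
  proof (intro allI impI)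
    fix e :: real assume "e > 0"
    then have "e / 2 > 0" by simp
    from near[OF this] obtain M
      where M: "\<And>m t. m \<ge> M \<Longrightarrow> t \<in> {0..1} \<Longrightarrow> \<bar>fs_A p a \<theta> m t - A t\<bar> < e / 2"
      by blast
    have "\<bar>fs_A p a \<theta> m s - fs_A p a \<theta> n s\<bar> \<le> e"
      if "m \<ge> M" "n \<ge> M" "s \<in> dyadics (max m n)" for m n s
    proof -
      have "s \<in> {0..1}" using that(3) dyadics_subset by blast
      then show ?thesis using M[OF that(1)] M[OF that(2)] by (smt (verit) field_sum_of_halves)
    qed
    then show "\<exists>M. \<forall>m\<ge>M. \<forall>n\<ge>M. \<forall>s\<in>dyadics (max m n). \<bar>fs_A p a \<theta> m s - fs_A p a \<theta> n s\<bar> \<le> e"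
      by blast
  qed
  show "dyadic_nondegenerate p a \<theta>"
    using dyadic_nondegenerate_iff[OF tendsto_uniform_limitI[OF lim, of 1]] A
    by (simp add: is_rough_variation_def)
  show "block_cancellation p a \<theta>"
    unfolding block_cancellation_iff
  proof (intro allI impI)
    fix e :: real assume "e > 0"
    then have "e / 2 > 0" by simp
    from near[OF this] obtain M
      where M: "\<And>m t. m \<ge> M \<Longrightarrow> t \<in> {0..1} \<Longrightarrow> \<bar>fs_A p a \<theta> m t - A t\<bar> < e / 2"
      by blast
    obtain \<delta> where \<delta>: "\<delta> > 0" "\<And>l c t. 0 < l \<Longrightarrow> l \<le> \<delta> \<Longrightarrow> 0 \<le> c \<Longrightarrow> c < l \<Longrightarrow> t \<in> {0..1} \<Longrightarrow>
        \<bar>p_sum p (shifted_grid l c) x t - A t\<bar> \<le> e / 2"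
    proof -
      have "e / 2 > 0" using \<open>e > 0\<close> by simp
      with A show ?thesis
        unfolding is_rough_variation_def is_rough_variation_limit_iff using that by blast
    qed
    \<comment> \<open>With \<open>L > 1 / \<delta>\<close>, the constraint
      \<open>b \<le> 2 ^ m div L\<close> forces the mesh \<open>b / 2 ^ m\<close> below
      \<open>\<delta>\<close>.\<close>
    obtain L0 :: nat where L0: "1 / \<delta> < real L0" using reals_Archimedean2 by blast
    have "\<bar>(\<Sum>j<k. cross_term p (fs_P p a \<theta> b r m j) (fs_Z p a \<theta> m j)) / 2 ^ m\<bar> \<le> e"
      if "L \<ge> L0" "m \<ge> M" "b \<in> {L..2 ^ m div L}" "r < b" "k \<le> 2 ^ m" for L m b r k
    proof -
      have L: "1 / \<delta> < real L" using L0 that(1) by (meson less_le_trans of_nat_le_iff)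
      then have "real L > 0" using \<delta>(1) by (meson less_trans zero_less_divide_1_iff)
      then have Lpos: "L > 0" by simp
      then have "b * L \<le> 2 ^ m" using that(3) by (simp add: less_eq_div_iff_mult_less_eq)
      then have bL: "real b * real L \<le> 2 ^ m"
        by (metis of_nat_le_iff of_nat_mult of_nat_numeral of_nat_power)
      have "b \<le> b * L" using Lpos by simp
      then have b2: "b \<le> 2 ^ m" using \<open>b * L \<le> 2 ^ m\<close> by linarith
      have "real b / 2 ^ m \<le> 1 / real L"
        using bL \<open>real L > 0\<close> by (simp add: field_simps)
      also have "\<dots> \<le> \<delta>"
        using L \<open>real L > 0\<close> \<delta>(1) by (simp add: field_simps)
      finally have "real b / 2 ^ m \<le> \<delta>" .
      moreover have k: "real k / 2 ^ m \<in> {0..1}"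
        using that(5) dyadics_subset[of m] by (auto simp: dyadics_eq_image)
      ultimately have "\<bar>p_sum p (shifted_grid (real b / 2 ^ m) (real r / 2 ^ m)) x (real k / 2 ^ m)
          - A (real k / 2 ^ m)\<bar> \<le> e / 2"
        using that(4) by (intro \<delta>(2)) (auto simp: divide_strict_right_mono)
      moreover have "\<bar>fs_A_dyadic p a \<theta> m k - A (real k / 2 ^ m)\<bar> < e / 2"
        using M[OF that(2) k] by (simp add: fs_A_dyadic_point)
      ultimately show ?thesis
        unfolding a_def \<theta>_def block_cross_sum_eq[OF assms(1) that(4) b2 that(5)] by linarith
    qed
    then show "\<exists>L0. \<forall>L\<ge>L0. \<forall>\<^sub>F m in sequentially. \<forall>b\<in>{L..2 ^ m div L}. \<forall>r<b. \<forall>k\<le>2 ^ m.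
        \<bar>(\<Sum>j<k. cross_term p (fs_P p a \<theta> b r m j) (fs_Z p a \<theta> m j)) / 2 ^ m\<bar> \<le> e"
      unfolding eventually_sequentially by blast
  qed
qed

section \<open>From the dyadic conditions to roughness\<close>

text \<open>Mesh, shift and time are rounded down to level \<open>m\<close>. How large
  \<open>m\<close> must be depends on them, but the bound from (iii) does not, so the limit in
  \<open>m\<close> keeps a bound uniform over all grids of small mesh.\<close>

lemma dyadic_conditions_imp_rough_variation:
  assumes "p > 0" and x: "continuous_on {0..1} x"
  defines "a \<equiv> x 1 - x 0" and "\<theta> \<equiv> fs_coeff x"
  assumes cauchy: "dyadic_cauchy p a \<theta>" and nondeg: "dyadic_nondegenerate p a \<theta>"
    and block: "block_cancellation p a \<theta>"
  shows "\<exists>A. is_rough_variation p x A"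
proof -
  \<comment> \<open>Numerator of the largest level-\<open>m\<close> dyadic not exceeding
    \<open>t\<close>, for nonnegative \<open>t\<close>.\<close>
  define fl where "fl t m = nat \<lfloor>2 ^ m * t\<rfloor>" for t :: real and m :: nat
  have fl: "(\<lambda>m. real (fl t m) / 2 ^ m) \<longlonglongrightarrow> t" if "0 \<le> t" for t
    unfolding fl_def by (rule dyadic_floor_tendsto[OF that])
  have fl_le: "real (fl t m) \<le> 2 ^ m * t" if "0 \<le> t" for t m
    using that by (simp add: fl_def)
  have fl_1: "fl t m \<le> 2 ^ m" if "t \<in> {0..1}" for t m
  proof -
    have "real (fl t m) \<le> 2 ^ m * t" using fl_le that by simp
    also have "\<dots> \<le> real (2 ^ m)" using that by simp
    finally show ?thesis by (simp only: of_nat_le_iff)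
  qed
  have fl_unit: "real (fl t m) / 2 ^ m \<in> {0..1}" if "t \<in> {0..1}" for t m
    using fl_1[OF that, of m] dyadics_subset[of m] by (auto simp: dyadics_eq_image)
  have "uniformly_Cauchy_on {0..1} (fs_A p a \<theta>)"
    unfolding uniformly_Cauchy_on_def
  proof (intro allI impI)
    fix e :: real assume "e > 0"
    then have "e / 2 > 0" by simp
    then obtain M where M: "\<And>m n s. m \<ge> M \<Longrightarrow> n \<ge> M \<Longrightarrow> s \<in> dyadics (max m n) \<Longrightarrow>
        \<bar>fs_A p a \<theta> m s - fs_A p a \<theta> n s\<bar> \<le> e / 2"
      using cauchy unfolding dyadic_cauchy_iff by blast
    have "dist (fs_A p a \<theta> m t) (fs_A p a \<theta> n t) < e" if "t \<in> {0..1}" "m \<ge> M" "n \<ge> M" for t m n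
      using fs_A_diff_le[OF M[OF that(2,3)] that(1)] \<open>e > 0\<close> by (simp add: dist_real_def)
    then show "\<exists>M. \<forall>t\<in>{0..1}. \<forall>m\<ge>M. \<forall>n\<ge>M. dist (fs_A p a \<theta> m t) (fs_A p a \<theta> n t) < e"
      by blast
  qed
  then obtain A where lim: "uniform_limit {0..1} (fs_A p a \<theta>) A sequentially"
    using Cauchy_uniformly_convergent uniformly_convergent_on_def by blast
  have cont: "continuous_on {0..1} A"
    by (rule uniform_limit_theorem[OF _ lim]) (auto intro: always_eventually continuous_on_fs_A)
  have dyadic_lim: "(\<lambda>m. fs_A_dyadic p a \<theta> m (fl t m)) \<longlonglongrightarrow> A t" if "t \<in> {0..1}" for t
    using uniform_limit_tendsto_diagonal[OF lim cont fl fl_unit[OF that] that] that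
    by (simp add: fs_A_dyadic_point)
  have mono: "mono_on {0..1} A"
  proof (rule mono_onI)
    fix s t :: real assume st: "s \<in> {0..1}" "t \<in> {0..1}" "s \<le> t"
    \<comment> \<open>Both sides are partial sums of nonnegative terms, and rounding down preserves
      the order of \<open>s\<close> and \<open>t\<close>.\<close>
    have "fs_A_dyadic p a \<theta> m (fl s m) \<le> fs_A_dyadic p a \<theta> m (fl t m)" for m
      using st unfolding fs_A_dyadic_def
      by (intro divide_right_mono sum_mono2) (auto simp: fl_def intro!: less_le_trans nat_mono floor_mono)
    then show "A s \<le> A t"
      using dyadic_lim[OF st(1)] dyadic_lim[OF st(2)] by (intro LIMSEQ_le) auto
  qed
  have A0: "A 0 = 0"
    using dyadic_lim[of 0] by (simp add: fl_def fs_A_dyadic_def LIMSEQ_const_iff)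
  have A1: "0 < A 1"
    using nondeg dyadic_nondegenerate_iff[OF tendsto_uniform_limitI[OF lim, of 1]] by simp
  have "\<exists>\<delta>>0. \<forall>l c t. 0 < l \<longrightarrow> l \<le> \<delta> \<longrightarrow> 0 \<le> c \<longrightarrow> c < l \<longrightarrow> t \<in> {0..1} \<longrightarrow>
      \<bar>p_sum p (shifted_grid l c) x t - A t\<bar> \<le> e" if e: "e > 0" for e
  proof -
    obtain L0 where L0: "\<And>L. L \<ge> L0 \<Longrightarrow> \<forall>\<^sub>F m in sequentially. \<forall>b\<in>{L..2 ^ m div L}. \<forall>r<b. \<forall>k\<le>2 ^ m.
        \<bar>(\<Sum>j<k. cross_term p (fs_P p a \<theta> b r m j) (fs_Z p a \<theta> m j)) / 2 ^ m\<bar> \<le> e"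
      using block e unfolding block_cancellation_iff by blast
    \<comment> \<open>The successor makes \<open>L\<close> positive, so that \<open>1 / L\<close>
      can serve as \<open>\<delta>\<close>.\<close>
    define L where "L = Suc L0"
    have "\<bar>p_sum p (shifted_grid l c) x t - A t\<bar> \<le> e"
      if l: "0 < l" "l \<le> 1 / real L" and c: "0 \<le> c" "c < l" and t: "t \<in> {0..1}" for l c t
    proof (rule tendsto_upperbound)
      show "(\<lambda>m. \<bar>p_sum p (shifted_grid (real (fl l m) / 2 ^ m) (real (fl c m) / 2 ^ m)) x (real (fl t m) / 2 ^ m)
          - fs_A_dyadic p a \<theta> m (fl t m)\<bar>) \<longlonglongrightarrow> \<bar>p_sum p (shifted_grid l c) x t - A t\<bar>"
        by (intro tendsto_rabs tendsto_diff dyadic_lim[OF t]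
              p_sum_shifted_grid_tendsto[OF x \<open>p > 0\<close> l(1) c t] fl fl_unit[OF t])
           (use l c t in auto)
      \<comment> \<open>The mesh bound \<open>l \<le> 1 / L\<close> puts the rounded mesh into the
        upper range of (iii) at every level.\<close>
      have b_le: "fl l m \<le> 2 ^ m div L" for m
      proof -
        have "real (fl l m) * real L \<le> 2 ^ m * l * real L"
          using fl_le[of l m] l by (intro mult_right_mono) auto
        also have "\<dots> \<le> 2 ^ m * 1"
          using l unfolding mult.assoc by (intro mult_left_mono) (auto simp: L_def field_simps)
        finally have "real (fl l m * L) \<le> real (2 ^ m)" by simp
        then have "fl l m * L \<le> 2 ^ m" by (simp only: of_nat_le_iff)
        then show ?thesis by (simp add: L_def less_eq_div_iff_mult_less_eq)
      qed
      \<comment> \<open>Since \<open>l > 0\<close>, the rounded mesh eventually has numerator at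
        least \<open>L\<close>; the next fact uses \<open>c < l\<close> to keep the rounded shift
        below the rounded mesh.\<close>
      have "\<forall>\<^sub>F m in sequentially. real L * (1 / 2) ^ m < l"
        using l tendsto_mult_right_zero[OF LIMSEQ_power_zero[of "1 / 2 :: real"], of "real L"]
        by (intro order_tendstoD(2)) auto
      moreover have "\<forall>\<^sub>F m in sequentially. 0 < real (fl l m) / 2 ^ m - real (fl c m) / 2 ^ m"
        by (rule order_tendstoD(1)[OF tendsto_diff[OF fl fl]]) (use l c in auto)
      moreover have "\<forall>\<^sub>F m in sequentially. \<forall>b\<in>{L..2 ^ m div L}. \<forall>r<b. \<forall>k\<le>2 ^ m.
        \<bar>(\<Sum>j<k. cross_term p (fs_P p a \<theta> b r m j) (fs_Z p a \<theta> m j)) / 2 ^ m\<bar> \<le> e"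
        by (rule L0) (simp add: L_def)
      ultimately show "\<forall>\<^sub>F m in sequentially.
        \<bar>p_sum p (shifted_grid (real (fl l m) / 2 ^ m) (real (fl c m) / 2 ^ m)) x (real (fl t m) / 2 ^ m)
          - fs_A_dyadic p a \<theta> m (fl t m)\<bar> \<le> e"
      proof eventually_elim
        case (elim m)
        have "real L \<le> 2 ^ m * l"
          using elim(1) by (simp add: power_divide field_simps)
        then have "int L \<le> \<lfloor>2 ^ m * l\<rfloor>" by (simp add: le_floor_iff)
        then have "L \<le> fl l m" by (simp add: fl_def)
        then have b: "fl l m \<in> {L..2 ^ m div L}" using b_le by simp
        have r: "fl c m < fl l m" using elim(2) by (simp add: divide_less_cancel)
        have "fl l m \<le> 2 ^ m" using b_le[of m] div_le_dividend[of "2 ^ m" L] by linarith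
        from block_cross_sum_eq[OF _ r this fl_1[OF t, of m], of p x] \<open>p > 0\<close>
        show ?case
          using elim(3)[rule_format, OF b r fl_1[OF t]] unfolding a_def \<theta>_def by simp
      qed
    qed simp
    then show ?thesis by (intro exI[of _ "1 / real L"]) (auto simp: L_def)
  qed
  then have "is_rough_variation p x A"
    unfolding is_rough_variation_def is_rough_variation_limit_iff
    using cont mono A0 A1 mono_onD[OF mono, of 0] by auto
  then show ?thesis by blast
qed

theorem proposition4p2:
  fixes p a :: real and x :: "real \<Rightarrow> real" and \<theta> :: "nat \<Rightarrow> nat \<Rightarrow> real"
  assumes "p > 1"
    and "continuous_on {0..1} x"
    and "a = x 1 - x 0"
    and "\<theta> = fs_coeff x"
  shows "(p_rough p x \<longleftrightarrow>
            dyadic_cauchy p a \<theta> \<and> dyadic_nondegenerate p a \<theta> \<and> block_cancellation p a \<theta>) \<and>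
         (dyadic_cauchy p a \<theta> \<and> dyadic_nondegenerate p a \<theta> \<and> block_cancellation p a \<theta> \<longrightarrow>
            uniform_limit {0..1} (fs_A p a \<theta>) (rough_variation p x) sequentially)"
proof -
  have rough: "p_rough p x \<longleftrightarrow>
      dyadic_cauchy p a \<theta> \<and> dyadic_nondegenerate p a \<theta> \<and> block_cancellation p a \<theta>"
    using is_rough_variation_imp_dyadic_conditions[of p x] dyadic_conditions_imp_rough_variation[of p x] assms
    unfolding p_rough_def by auto
  moreover have "uniform_limit {0..1} (fs_A p a \<theta>) (rough_variation p x) sequentially" if "p_rough p x"
  proof -
    obtain A where A: "is_rough_variation p x A" using \<open>p_rough p x\<close> by (auto simp: p_rough_def)
    then have "uniform_limit {0..1} (fs_A p a \<theta>) A sequentially"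
      using uniform_limit_fs_A[of p x A] assms by simp
    \<comment> \<open>\<open>rough_variation p x\<close> agrees with \<open>A\<close> on the unit
      interval, so the uniform limit carries over.\<close>
    then show ?thesis
      by (rule uniform_limit_cong'[THEN iffD1, rotated -1]) (simp_all add: rough_variation_eq[OF A])
  qed
  ultimately show ?thesis by blast
qed

end
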